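(* For every positive integer $k$, $$\tilde{c}_k \geq 1 - \frac{2}{k!}\sum^{\lfloor k/3 \rfloor}_{i=0} (-1)^i \binom{k}{i} \left(\frac{k}{3}-i\right)^k.$$
   Context: A subset $A$ of an additive group is called sumfree if $x+y\neq z$ for all $x,y,z\in A$ (not necessarily distinct). For a positive integer $k$, subsets of $[0,1]^k$ are regarded as subsets of the additive group $\mathbb{R}^k$, $\mathrm{Vol}$ denotes Lebesgue measure on $\mathbb{R}^k$, and $$\tilde{c}_k := \sup \{\mathrm{Vol}(S) : S \subset [0,1]^k \text{ is Lebesgue measurable and sumfree}\}.$$ *)

theory Defs
  imports "HOL-Analysis.Analysis"
begin

definition sumfree :: "'a::ab_group_add set \<Rightarrow> bool" where
  "sumfree A \<longleftrightarrow> (\<forall>x\<in>A. \<forall>y\<in>A. \<forall>z\<in>A. x + y \<noteq> z)"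

(* The dimension k is CARD('n); (1 :: real ^ 'n) is the all-ones vector, so cbox 0 1 is the
   unit cube [0,1]^k. The set of volumes contains 0 (from S = {}) and is bounded above by 1,
   so the real supremum is the genuine one. *)
definition sumfree_vol_sup :: "'n::finite itself \<Rightarrow> real" where
  "sumfree_vol_sup (_ :: 'n itself) =
     Sup {measure lebesgue S | S :: (real ^ 'n) set.
            S \<subseteq> cbox 0 1 \<and> S \<in> sets lebesgue \<and> sumfree S}"

end

(* Vectors whose coordinate sum s satisfies k/3 < s < 2k/3 form a sumfree set. The part of
   the cube with s <= k/3 and its mirror image under x -> 1 - x cover the rest of the cube.
   Inclusion-exclusion over the coordinates that are at least 1 expresses the volume of that
   part by volumes of translated simplices. *)
theory Submission
  imports Defs
begin

text \<open>The volumes met in the inclusion-exclusion below depend on a set of coordinates only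
  through its size. Grouping the sets by size is what brings in the binomial coefficients.\<close>

lemma sum_Pow_card:
  fixes g :: "nat \<Rightarrow> 'b::comm_semiring_1"
  assumes "finite A"
  shows "(\<Sum>X\<in>Pow A. g (card X)) = (\<Sum>i\<le>card A. of_nat (card A choose i) * g i)"
proof -
  have "(\<Sum>X\<in>Pow A. g (card X)) = (\<Sum>i\<le>card A. \<Sum>X | X \<in> Pow A \<and> card X = i. g (card X))"
    using assms by (intro sum.group [symmetric]) (auto intro: card_mono)
  also have "\<dots> = (\<Sum>i\<le>card A. of_nat (card A choose i) * g i)"
    using assms by (intro sum.cong) (auto simp: n_subsets)
  finally show ?thesis .
qed

lemma sum_subset_Basis_inner:
  fixes i :: "'a::euclidean_space"
  assumes "A \<subseteq> Basis" "i \<in> Basis"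
  shows "\<Sum>A \<bullet> i = (if i \<in> A then 1 else 0)"
proof -
  have "finite A" using assms(1) finite_Basis by (rule finite_subset)
  have "\<Sum>A \<bullet> i = (\<Sum>j\<in>A. if j = i then 1 else 0)"
    unfolding inner_sum_left using assms by (intro sum.cong) (auto simp: inner_Basis)
  then show ?thesis using \<open>finite A\<close> by simp
qed

text \<open>Leaving out the upper bounds of the cube is deliberate: imposing
  \<open>1 \<le> x \<bullet> i\<close> then yields a translate of a set of the same family. Negative
  \<open>s\<close> is allowed and gives the empty set.\<close>

definition scaled_simplex :: "real \<Rightarrow> 'a::euclidean_space set" where
  "scaled_simplex s = {x. (\<forall>i\<in>Basis. 0 \<le> x \<bullet> i) \<and> (\<Sum>i\<in>Basis. x \<bullet> i) \<le> s}"

lemma scaled_simplex_eq_image: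
  assumes "s \<ge> 0"
  shows "(scaled_simplex s :: 'a::euclidean_space set) =
    (\<lambda>x. s *\<^sub>R x + 0) ` (convex hull (insert 0 Basis))"
\<comment> \<open>For positive \<open>s\<close>, dividing by \<open>s\<close> inverts the scaling.
  At \<open>s = 0\<close> both sides collapse to the origin.\<close>
proof (cases "s = 0")
  case True
  have "(scaled_simplex 0 :: 'a set) = {0}"
  proof -
    have "x = 0" if "x \<in> scaled_simplex 0" for x :: 'a
    proof -
      have nn: "\<forall>i\<in>Basis. 0 \<le> x \<bullet> i" and "(\<Sum>i\<in>Basis. x \<bullet> i) \<le> 0"
        using that by (auto simp: scaled_simplex_def)
      then have "(\<Sum>i\<in>Basis. x \<bullet> i) = 0" by (intro antisym sum_nonneg) auto
      then have "\<forall>i\<in>Basis. x \<bullet> i = 0" using nn by (subst (asm) sum_nonneg_eq_0_iff) auto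
      then show ?thesis by (auto intro: euclidean_eqI [of x])
    qed
    then show ?thesis by (auto simp: scaled_simplex_def)
  qed
  moreover have "(\<lambda>x. 0 *\<^sub>R x + 0) ` (convex hull (insert 0 Basis)) = {0::'a}"
    by (auto simp: image_constant_conv)
  ultimately show ?thesis using True by simp
next
  case False
  with assms have s: "s > 0" by simp
  have "x \<in> (\<lambda>x. s *\<^sub>R x + 0) ` (convex hull (insert 0 Basis))" if "x \<in> scaled_simplex s" for x :: 'a
  proof
    show "x = s *\<^sub>R (x /\<^sub>R s) + 0" using s by simp
    show "x /\<^sub>R s \<in> convex hull (insert 0 Basis)"
      using that s by (auto simp: std_simplex scaled_simplex_def simp flip: sum_distrib_left)
        (simp add: field_simps)
  qed
  then show ?thesis
    using s by (auto simp: std_simplex scaled_simplex_def simp flip: sum_distrib_left)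
qed

lemma scaled_simplex_neg: "s < 0 \<Longrightarrow> scaled_simplex s = {}"
  by (smt (verit, best) Collect_empty_eq scaled_simplex_def sum_nonneg)

lemma lmeasurable_scaled_simplex: "(scaled_simplex s :: 'a::euclidean_space set) \<in> lmeasurable"
proof (cases "s < 0")
  case False
  have "compact (convex hull (insert 0 Basis) :: 'a set)"
    by (intro finite_imp_compact_convex_hull) auto
  then have "compact (scaled_simplex s :: 'a set)"
    using False by (subst scaled_simplex_eq_image)
      (auto intro!: compact_continuous_image continuous_intros)
  then show ?thesis by (rule lmeasurable_compact)
qed (simp add: scaled_simplex_neg)

lemma measure_scaled_simplex:
  "measure lebesgue (scaled_simplex s :: 'a::euclidean_space set) =
    (if s < 0 then 0 else s ^ DIM('a) / fact DIM('a))"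
proof (cases "s < 0")
  case False
  have "closed (convex hull (insert 0 Basis) :: 'a set)"
    by (intro compact_imp_closed finite_imp_compact_convex_hull) auto
  then have "measure lebesgue (convex hull (insert 0 Basis) :: 'a set) = 1 / fact DIM('a)"
    by (simp add: content_std_simplex)
  then show ?thesis
    using False by (simp add: scaled_simplex_eq_image measure_lebesgue_affine del: add_0_right)
qed (simp add: scaled_simplex_neg)

text \<open>Subtracting 1 from each coordinate in \<open>A\<close> turns the bounds
  \<open>1 \<le> x \<bullet> i\<close> back into nonnegativity, leaves the other coordinates alone
  and lowers the coordinate sum by \<open>card A\<close>.\<close>

lemma scaled_simplex_ge_1:
  assumes A: "A \<subseteq> (Basis :: 'a::euclidean_space set)"
  shows "{x \<in> scaled_simplex t. \<forall>i\<in>A. 1 \<le> x \<bullet> i} =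
    (+) (\<Sum>A) ` scaled_simplex (t - real (card A))"
proof -
  have nz: "(\<Sum>i\<in>Basis. \<Sum>A \<bullet> i) = real (card A)"
  proof -
    have "(\<Sum>i\<in>Basis. \<Sum>A \<bullet> i) = (\<Sum>i\<in>Basis. if i \<in> A then 1 else 0)"
      by (intro sum.cong) (auto simp: sum_subset_Basis_inner A)
    also have "\<dots> = real (card A)"
      using A by (simp add: sum.If_cases Int_absorb1)
    finally show ?thesis .
  qed
  have "x \<in> scaled_simplex t \<and> (\<forall>i\<in>A. 1 \<le> x \<bullet> i) \<longleftrightarrow>
      x - \<Sum>A \<in> scaled_simplex (t - real (card A))" for x
  proof -
    have "(\<forall>i\<in>Basis. 0 \<le> x \<bullet> i) \<and> (\<forall>i\<in>A. 1 \<le> x \<bullet> i) \<longleftrightarrow> (\<forall>i\<in>Basis. 0 \<le> (x - \<Sum>A) \<bullet> i)"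
      using A by (force simp: inner_diff_left sum_subset_Basis_inner)
    then show ?thesis
      by (auto simp: scaled_simplex_def inner_diff_left sum_subtractf nz)
  qed
  then show ?thesis
    by (auto simp: image_iff) (metis add.commute diff_add_cancel)+
qed

lemma measure_scaled_simplex_lt_1:
  fixes t :: real
  defines "L \<equiv> {x \<in> scaled_simplex t. \<forall>i\<in>Basis. x \<bullet> i < 1} :: 'a::euclidean_space set"
  shows "measure lebesgue L = (\<Sum>A\<in>Pow (Basis :: 'a set).
      (- 1) ^ card A * measure lebesgue (scaled_simplex (t - real (card A)) :: 'a set))"
    and "L \<in> lmeasurable"
proof -
  define G :: "'a set \<Rightarrow> 'a set" where "G A = {x \<in> scaled_simplex t. \<forall>i\<in>A. 1 \<le> x \<bullet> i}" for A
  have G: "G A \<in> lmeasurable"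
    "measure lebesgue (G A) = measure lebesgue (scaled_simplex (t - real (card A)) :: 'a set)"
    if "A \<in> Pow Basis" for A
    using that unfolding G_def by (simp_all add: scaled_simplex_ge_1 measurable_translation
        lmeasurable_scaled_simplex measure_translation)
  have ind: "indicator L x = (\<Sum>A\<in>Pow Basis. (- 1) ^ card A * (indicator (G A) x :: real))" for x
  proof -
    \<comment> \<open>Each factor is 1 if \<open>x \<bullet> i < 1\<close> and 0 otherwise.
      Expanding the product over all sets of coordinates is inclusion-exclusion at the point
      \<open>x\<close>; integrating it later gives the volume.\<close>
    have "indicator L x =
        indicator (scaled_simplex t) x * (\<Prod>i\<in>Basis. (- of_bool (1 \<le> x \<bullet> i)) + (1 :: real))"
      by (cases "\<exists>i\<in>Basis. 1 \<le> x \<bullet> i")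
        (auto simp: L_def indicator_def not_le not_less intro!: prod.neutral)
    also have "\<dots> = indicator (scaled_simplex t) x *
        (\<Sum>A\<in>Pow Basis. (\<Prod>i\<in>A. - of_bool (1 \<le> x \<bullet> i)))"
      by (subst prod_add) auto
    also have "\<dots> = (\<Sum>A\<in>Pow Basis. (- 1) ^ card A * (indicator (G A) x :: real))"
      unfolding sum_distrib_left
    proof (intro sum.cong refl)
      fix A :: "'a set" assume "A \<in> Pow Basis"
      then have "finite A" using finite_subset [OF _ finite_Basis] by auto
      \<comment> \<open>The signs contribute \<open>(- 1) ^ card A\<close>; the remaining product of
        zeros and ones is 1 exactly when every coordinate in \<open>A\<close> is at least 1.\<close>
      then show "indicator (scaled_simplex t) x * (\<Prod>i\<in>A. - of_bool (1 \<le> x \<bullet> i)) =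
          (- 1) ^ card A * (indicator (G A) x :: real)"
        by (auto simp: G_def indicator_def prod_uminus prod_zero_iff intro!: prod.neutral)
    qed
    finally show ?thesis .
  qed
  have int: "integrable lebesgue (\<lambda>x. (- 1) ^ card A * (indicator (G A) x :: real))"
    if "A \<in> Pow Basis" for A
    using G(1) [OF that] by (intro integrable_mult_right) (auto simp: fmeasurable_def)
  have "L = scaled_simplex t - (\<Union>i\<in>Basis. G {i})"
    by (auto simp: L_def G_def)
  then show "L \<in> lmeasurable"
    using G(1) by (auto intro!: fmeasurable.Diff fmeasurable.finite_UN lmeasurable_scaled_simplex)
  have "measure lebesgue L = integral\<^sup>L lebesgue (indicator L :: 'a \<Rightarrow> real)"
    by simp
  also have "\<dots> = (\<Sum>A\<in>Pow Basis. (- 1) ^ card A * measure lebesgue (G A))"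
    unfolding ind using int by (subst Bochner_Integration.integral_sum) auto
  also have "\<dots> = (\<Sum>A\<in>Pow (Basis :: 'a set).
      (- 1) ^ card A * measure lebesgue (scaled_simplex (t - real (card A)) :: 'a set))"
    using G(2) by (intro sum.cong) auto
  finally show "measure lebesgue L = (\<Sum>A\<in>Pow (Basis :: 'a set).
      (- 1) ^ card A * measure lebesgue (scaled_simplex (t - real (card A)) :: 'a set))" .
qed

lemma measure_cube_sum_le:
  fixes t :: real
  defines "L \<equiv> {x \<in> cbox 0 One. (\<Sum>i\<in>Basis. x \<bullet> i) \<le> t} :: 'a::euclidean_space set"
  shows "measure lebesgue L = (\<Sum>i | i \<le> DIM('a) \<and> real i \<le> t.
      (- 1) ^ i * real (DIM('a) choose i) * (t - real i) ^ DIM('a)) / fact DIM('a)"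
proof -
  define L' :: "'a set" where "L' = {x \<in> scaled_simplex t. \<forall>i\<in>Basis. x \<bullet> i < 1}"
  \<comment> \<open>The cube in \<open>L\<close> is closed, while \<open>L'\<close> demands
    coordinates strictly below 1. The two sets can differ only on the boundary of the cube, which is
    negligible.\<close>
  have "(L - L') \<union> (L' - L) \<subseteq> cbox 0 One - box 0 One"
    by (fastforce simp: L_def L'_def scaled_simplex_def mem_box)
  then have neg: "negligible (sym_diff L' L)"
    using negligible_frontier_interval negligible_subset
    by (metis Un_commute)
  have L': "L' \<in> lmeasurable" unfolding L'_def by (rule measure_scaled_simplex_lt_1)
  have "measure lebesgue L = measure lebesgue L'"
    using neg L' measure_negligible_symdiff by blast
  also have "\<dots> = (\<Sum>A\<in>Pow (Basis :: 'a set).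
      (- 1) ^ card A * measure lebesgue (scaled_simplex (t - real (card A)) :: 'a set))"
    unfolding L'_def by (rule measure_scaled_simplex_lt_1)
  also have "\<dots> = (\<Sum>i\<le>DIM('a). real (DIM('a) choose i) *
      ((- 1) ^ i * measure lebesgue (scaled_simplex (t - real i) :: 'a set)))"
    by (rule sum_Pow_card) simp
  \<comment> \<open>The sum is cut off at \<open>t\<close> because the simplices of negative size
    are empty.\<close>
  also have "\<dots> = (\<Sum>i | i \<le> DIM('a) \<and> real i \<le> t. real (DIM('a) choose i) *
      ((- 1) ^ i * ((t - real i) ^ DIM('a) / fact DIM('a))))"
    by (intro sum.mono_neutral_cong_right) (auto simp: measure_scaled_simplex)
  also have "\<dots> = (\<Sum>i | i \<le> DIM('a) \<and> real i \<le> t.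
      (- 1) ^ i * real (DIM('a) choose i) * (t - real i) ^ DIM('a)) / fact DIM('a)"
    by (simp add: sum_divide_distrib mult_ac)
  finally show "measure lebesgue L = (\<Sum>i | i \<le> DIM('a) \<and> real i \<le> t.
      (- 1) ^ i * real (DIM('a) choose i) * (t - real i) ^ DIM('a)) / fact DIM('a)" .
qed

text \<open>Coordinate sums are additive, so the sum of two members has coordinate sum above
  \<open>2 * t\<close>.\<close>

lemma sumfree_coordinate_sum_between:
  "sumfree {x \<in> X. t < (\<Sum>i\<in>Basis. x \<bullet> i) \<and> (\<Sum>i\<in>Basis. x \<bullet> i) < 2 * t}"
  by (auto simp: sumfree_def inner_add_left sum.distrib)

text \<open>The cube is covered by \<open>S\<close>, \<open>L\<close> and the reflection of
  \<open>L\<close> in the centre of the cube. Subadditivity gives the bound for every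
  \<open>t\<close>, even when \<open>L\<close> and its reflection overlap.\<close>

lemma measure_cube_sum_between:
  fixes t :: real
  defines "S \<equiv> {x \<in> cbox 0 One. t < (\<Sum>i\<in>Basis. x \<bullet> i) \<and>
      (\<Sum>i\<in>Basis. x \<bullet> i) < real DIM('a) - t} :: 'a::euclidean_space set"
    and "L \<equiv> {x \<in> cbox 0 One. (\<Sum>i\<in>Basis. x \<bullet> i) \<le> t} :: 'a set"
  shows "measure lebesgue S \<ge> 1 - 2 * measure lebesgue L"
    and "S \<in> lmeasurable"
proof -
  \<comment> \<open>The reflection is written as an affine map so that
    \<open>measure_lebesgue_affine\<close> applies; the factor -1 preserves volume.\<close>
  define R where "R = (\<lambda>x. (- 1) *\<^sub>R x + One) ` L"
  have "L = cbox 0 One \<inter> {x. (\<Sum>i\<in>Basis. x \<bullet> i) \<le> t}"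
    by (auto simp: L_def)
  then have "compact L"
    by (auto intro!: compact_Int_closed closed_Collect_le continuous_intros)
  then have L: "L \<in> lmeasurable" and "compact R"
    unfolding R_def
    by (auto intro!: lmeasurable_compact compact_continuous_image continuous_intros)
  then have R: "R \<in> lmeasurable" "measure lebesgue R = measure lebesgue L"
    using measure_lebesgue_affine [of "- 1" One L] by (simp_all add: R_def lmeasurable_compact)
  \<comment> \<open>The map from \<open>x\<close> to \<open>One - x\<close> is its own inverse, so
    the image is also a preimage.\<close>
  have "x \<in> R \<longleftrightarrow> One - x \<in> L" for x
  proof
    assume "One - x \<in> L"
    then show "x \<in> R" unfolding R_def by (rule rev_image_eqI) simp
  qed (auto simp: R_def)
  then have R_eq: "R = {x \<in> cbox 0 One. real DIM('a) - t \<le> (\<Sum>i\<in>Basis. x \<bullet> i)}"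
    by (auto simp: L_def mem_box inner_diff_left sum_subtractf)
  have S_eq: "S = cbox 0 One - L - R"
    unfolding R_eq by (auto simp: S_def L_def)
  show S: "S \<in> lmeasurable" unfolding S_eq using L R by (intro fmeasurable.Diff) auto
  have "1 = measure lebesgue (cbox 0 (One :: 'a))"
    by simp
  also have "\<dots> \<le> measure lebesgue (S \<union> (L \<union> R))"
    by (rule measure_mono_fmeasurable) (use S L R in \<open>auto simp: S_eq\<close>)
  also have "\<dots> \<le> measure lebesgue S + (measure lebesgue L + measure lebesgue R)"
    using S L R measure_Un_le [of S lebesgue "L \<union> R"] measure_Un_le [of L lebesgue R]
    by (auto dest!: fmeasurableD)
  finally show "measure lebesgue S \<ge> 1 - 2 * measure lebesgue L"
    using R by simp
qed

lemma measure_le_sumfree_vol_sup: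
  fixes S :: "(real ^ 'n::finite) set"
  assumes "S \<subseteq> cbox 0 1" "S \<in> sets lebesgue" "sumfree S"
  shows "measure lebesgue S \<le> sumfree_vol_sup TYPE('n)"
  unfolding sumfree_vol_sup_def
proof (rule cSup_upper)
  show "bdd_above {measure lebesgue S | S :: (real ^ 'n) set.
      S \<subseteq> cbox 0 1 \<and> S \<in> sets lebesgue \<and> sumfree S}"
    by (intro bdd_aboveI [of _ "measure lebesgue (cbox 0 (1 :: real ^ 'n))"])
      (use measure_mono_fmeasurable lmeasurable_cbox in blast)
qed (use assms in blast)

text \<open>Links the sum of the basis vectors, used for general Euclidean spaces above, with the
  all-ones vector in the definition of \<open>sumfree_vol_sup\<close>.\<close>

lemma One_cart: "(One :: real ^ 'n::finite) = 1"
proof (rule euclidean_eqI)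
  fix b :: "real ^ 'n" assume b: "b \<in> Basis"
  then obtain i where "b = axis i 1" by (auto simp: Basis_vec_def)
  then have "1 \<bullet> b = 1" by (simp add: inner_axis)
  then show "One \<bullet> b = 1 \<bullet> b" using b by simp
qed

theorem theorem5p1:
  fixes k :: nat
  assumes "k = CARD('n::finite)"
  shows "sumfree_vol_sup TYPE('n) \<ge>
    1 - 2 / fact k *
      (\<Sum>i = 0..k div 3. (-1) ^ i * real (k choose i) * (real k / 3 - real i) ^ k)"
proof -
  have k: "DIM(real ^ 'n) = k" using assms by simp
  \<comment> \<open>The value \<open>t = k/3\<close> solves \<open>k - t = 2 * t\<close>, so the
    upper bound serves both the reflection argument and sumfreeness.\<close>
  define S :: "(real ^ 'n) set" where
    "S = {x \<in> cbox 0 One. real k / 3 < (\<Sum>i\<in>Basis. x \<bullet> i) \<and> (\<Sum>i\<in>Basis. x \<bullet> i) < real k - real k / 3}"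
  have S: "S \<in> lmeasurable"
    "measure lebesgue S \<ge> 1 - 2 * measure lebesgue
      {x \<in> cbox 0 (One :: real ^ 'n). (\<Sum>i\<in>Basis. x \<bullet> i) \<le> real k / 3}"
    unfolding S_def k [symmetric] by (rule measure_cube_sum_between)+
  \<comment> \<open>For natural \<open>i\<close>, being at most \<open>k/3\<close> means being at
    most its floor, which already implies \<open>i \<le> k\<close>.\<close>
  have "{i. i \<le> k \<and> real i \<le> real k / 3} = {0..k div 3}"
    by auto
  then have "measure lebesgue {x \<in> cbox 0 (One :: real ^ 'n). (\<Sum>i\<in>Basis. x \<bullet> i) \<le> real k / 3} =
    (\<Sum>i = 0..k div 3. (-1) ^ i * real (k choose i) * (real k / 3 - real i) ^ k) / fact k"
    using measure_cube_sum_le [where 'a = "real ^ 'n" and t = "real k / 3"] unfolding k by simp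
  moreover have "sumfree S"
    using sumfree_coordinate_sum_between [of "cbox 0 One" "real k / 3"] by (simp add: S_def)
  then have "measure lebesgue S \<le> sumfree_vol_sup TYPE('n)"
    using S(1) by (intro measure_le_sumfree_vol_sup) (auto simp: S_def One_cart fmeasurableD)
  ultimately show ?thesis using S(2) by simp
qed

end
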